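(* Let $G$ be a connected graph and $n\ge 1$. Then player B wins the general position avoidance game on the lexicographic product $G\circ K_n$ if and only if player B wins the general position avoidance game on $G$ and $n$ is odd.
   Context: The lexicographic product $G\circ H$ has vertex set $V(G)\times V(H)$, with $(g,h)$ adjacent to $(g',h')$ iff either $gg'\in E(G)$, or $g=g'$ and $hh'\in E(H)$. A set $S$ of vertices of a graph is a general position set if no three distinct vertices of $S$ lie on a common shortest path. In the general position avoidance game on a graph, players A and B alternately select vertices, with A moving first; a selection is legal if the vertex was not selected before and the set of all selected vertices is a general position set. The game ends when no legal move remains, and the player who selects the last vertex loses. "Player X wins" means X has a winning strategy. *)

theory Defs
  imports "Graph_Theory.Kuratowski" "Graph_Theory.Vertex_Walk"
begin

text \<open>
  A simple graph is a symmetric loop-free relation on a vertex set; each edge is the pair of its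
  two arcs. It is not required to be finite.
\<close>

abbreviation simple_graph :: "'a pair_pre_digraph \<Rightarrow> bool" where
  "simple_graph G \<equiv> pair_bidirected_digraph G"

definition lexicographic_product ::
    "'a pair_pre_digraph \<Rightarrow> 'b pair_pre_digraph \<Rightarrow> ('a \<times> 'b) pair_pre_digraph" where
  "lexicographic_product G H =
    \<lparr> pverts = pverts G \<times> pverts H,
      parcs = {((g, h), (g', h')) | g h g' h'.
        (g, h) \<in> pverts G \<times> pverts H \<and> (g', h') \<in> pverts G \<times> pverts H \<and>
        ((g, g') \<in> parcs G \<or> g = g' \<and> (h, h') \<in> parcs H)} \<rparr>"

definition shortest_path :: "'a pair_pre_digraph \<Rightarrow> 'a list \<Rightarrow> bool" where
  "shortest_path G p \<longleftrightarrow> vpath p (with_proj G) \<and>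
    (\<forall>q. vpath q (with_proj G) \<and> hd q = hd p \<and> last q = last p
      \<longrightarrow> vwalk_length p \<le> vwalk_length q)"

definition general_position_set :: "'a pair_pre_digraph \<Rightarrow> 'a set \<Rightarrow> bool" where
  "general_position_set G S \<longleftrightarrow> S \<subseteq> pverts G \<and>
    \<not> (\<exists>x\<in>S. \<exists>y\<in>S. \<exists>z\<in>S. x \<noteq> y \<and> x \<noteq> z \<and> y \<noteq> z \<and>
        (\<exists>p. shortest_path G p \<and> {x, y, z} \<subseteq> set p))"

text \<open>
  A position of the game is the list of the vertices selected so far, in the order of selection.
\<close>

datatype player = Player_A | Player_B

definition to_move :: "'a list \<Rightarrow> player" where
  "to_move xs = (if even (length xs) then Player_A else Player_B)"

definition legal_moves :: "'a pair_pre_digraph \<Rightarrow> 'a list \<Rightarrow> 'a set" where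
  "legal_moves G xs =
    {v \<in> pverts G. v \<notin> set xs \<and> general_position_set G (insert v (set xs))}"

definition legal_play :: "'a pair_pre_digraph \<Rightarrow> 'a list \<Rightarrow> bool" where
  "legal_play G xs \<longleftrightarrow> (\<forall>i<length xs. xs ! i \<in> legal_moves G (take i xs))"

definition game_over :: "'a pair_pre_digraph \<Rightarrow> 'a list \<Rightarrow> bool" where
  "game_over G xs \<longleftrightarrow> legal_moves G xs = {}"

definition selected_last :: "player \<Rightarrow> 'a list \<Rightarrow> bool" where
  "selected_last X xs \<longleftrightarrow> xs \<noteq> [] \<and> to_move (butlast xs) = X"

fun opponent :: "player \<Rightarrow> player" where
  "opponent Player_A = Player_B"
| "opponent Player_B = Player_A"

definition follows :: "player \<Rightarrow> ('a list \<Rightarrow> 'a) \<Rightarrow> 'a list \<Rightarrow> bool" where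
  "follows X \<sigma> xs \<longleftrightarrow>
    (\<forall>i<length xs. to_move (take i xs) = X \<longrightarrow> xs ! i = \<sigma> (take i xs))"

text \<open>
  The last conjunct requires that the game comes to an end; it is only relevant for infinite
  graphs, where a play that goes on forever is won by nobody.
\<close>

definition avoidance_winning_strategy ::
    "'a pair_pre_digraph \<Rightarrow> player \<Rightarrow> ('a list \<Rightarrow> 'a) \<Rightarrow> bool" where
  "avoidance_winning_strategy G X \<sigma> \<longleftrightarrow>
    (\<forall>xs. legal_play G xs \<and> follows X \<sigma> xs \<and> \<not> game_over G xs \<and> to_move xs = X
      \<longrightarrow> \<sigma> xs \<in> legal_moves G xs) \<and>
    (\<forall>xs. legal_play G xs \<and> follows X \<sigma> xs \<and> game_over G xs
      \<longrightarrow> selected_last (opponent X) xs) \<and>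
    \<not> (\<exists>f :: nat \<Rightarrow> 'a. \<forall>k. legal_play G (map f [0..<k]) \<and> follows X \<sigma> (map f [0..<k]))"

definition wins_avoidance_game :: "player \<Rightarrow> 'a pair_pre_digraph \<Rightarrow> bool" where
  "wins_avoidance_game X G \<longleftrightarrow> (\<exists>\<sigma>. avoidance_winning_strategy G X \<sigma>)"

end

theory Submission
  imports Defs
begin

text \<open>
  Vertices of a common fibre of \<open>G \<circ> K\<^sub>n\<close> are adjacent twins, so a set is in general position in the
  product iff its projection to \<open>G\<close> is. Hence a maximal general position set of the product is a
  union of complete fibres over a maximal one of \<open>G\<close>. If \<open>n\<close> is even, every finished play therefore
  has even length and B made the last move. If \<open>n\<close> is odd, the free places of an opened fibre can
  be paired off: moves in opened fibres are answered in the same fibre, and what remains is the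
  game on \<open>G\<close>.
\<close>

section \<open>General position sets via walk lengths\<close>

text \<open>Minimality of \<open>i + j\<close> forces \<open>i\<close> and \<open>j\<close> to be
  distances, so this says d(x,y) + d(y,z) = d(x,z) with all three finite. Relation powers count
  walks, which makes concatenating and cutting immediate.\<close>

definition between :: "('a \<times> 'a) set \<Rightarrow> 'a \<Rightarrow> 'a \<Rightarrow> 'a \<Rightarrow> bool" where
  "between R x y z \<longleftrightarrow> (\<exists>i j. (x, y) \<in> R ^^ i \<and> (y, z) \<in> R ^^ j \<and>
    (\<forall>k. (x, z) \<in> R ^^ k \<longrightarrow> i + j \<le> k))"

lemma set_vwalk_arcs_nth:
  "set (vwalk_arcs p) = {(p ! i, p ! Suc i) | i. Suc i < length p}"
proof (induction p rule: vwalk_arcs.induct)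
  case (3 x y xs)
  have "{((x # y # xs) ! i, (x # y # xs) ! Suc i) | i. Suc i < length (x # y # xs)}
      = insert (x, y) {((y # xs) ! i, (y # xs) ! Suc i) | i. Suc i < length (y # xs)}"
    (is "?L = ?R")
  proof
    show "?L \<subseteq> ?R"
    proof
      fix e assume "e \<in> ?L"
      then obtain i where "e = ((x # y # xs) ! i, (x # y # xs) ! Suc i)"
        "Suc i < length (x # y # xs)" by blast
      then show "e \<in> ?R" by (cases i) auto
    qed
    show "?R \<subseteq> ?L"
    proof
      fix e assume "e \<in> ?R"
      then consider "e = (x, y)"
        | i where "e = ((y # xs) ! i, (y # xs) ! Suc i)" "Suc i < length (y # xs)" by blast
      then show "e \<in> ?L"
      proof cases
        case 1 then show ?thesis by (auto intro: exI[of _ 0])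
      next
        case 2 then show ?thesis by (auto intro: exI[of _ "Suc i"])
      qed
    qed
  qed
  with 3 show ?case by simp
qed auto

lemma vwalk_with_proj_nth:
  "vwalk p (with_proj G) \<longleftrightarrow> p \<noteq> [] \<and> set p \<subseteq> pverts G \<and>
    (\<forall>i. Suc i < length p \<longrightarrow> (p ! i, p ! Suc i) \<in> parcs G)"
  by (auto simp: vwalk_def set_vwalk_arcs_nth)

lemma vwalk_nth_relpow:
  assumes "vwalk p (with_proj G)" "a \<le> b" "b < length p"
  shows "(p ! a, p ! b) \<in> parcs G ^^ (b - a)"
  unfolding relpow_fun_conv
  using assms by (intro exI[of _ "\<lambda>i. p ! (a + i)"]) (auto simp: vwalk_with_proj_nth)

lemma length_vwalk_to_vpath_le: "length (vwalk_to_vpath p) \<le> length p"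
proof (induction p rule: vwalk_to_vpath.induct)
  case (2 x xs)
  then show ?case
    using length_dropWhile_le[of "\<lambda>y. y \<noteq> x" xs] by (cases "x \<in> set xs") auto
qed auto

lemma (in pair_wf_digraph) vwalk_of_relpow_fun:
  assumes "f 0 \<in> pverts G" "\<And>i. i < n \<Longrightarrow> (f i, f (Suc i)) \<in> parcs G"
  shows "vwalk (map f [0..<Suc n]) (with_proj G)"
proof -
  have "f i \<in> pverts G" if "i \<le> n" for i
    using that assms(1) in_arcsD2[OF assms(2)] by (cases i) auto
  then show ?thesis
    unfolding vwalk_with_proj_nth using assms(2) by (auto simp del: upt_Suc)
qed

text \<open>Cutting the closed detours out of a walk keeps its ends and never lengthens it. This
  links \<open>shortest_path\<close>, which competes against paths, with \<open>between\<close>,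
  which competes against all walks.\<close>

lemma (in pair_wf_digraph) relpow_imp_vpath:
  assumes "x \<in> pverts G" "(x, y) \<in> parcs G ^^ k"
  obtains q where "vpath q (with_proj G)" "hd q = x" "last q = y" "vwalk_length q \<le> k"
proof -
  obtain f where f: "f 0 = x" "f k = y" "\<And>i. i < k \<Longrightarrow> (f i, f (Suc i)) \<in> parcs G"
    using assms(2) unfolding relpow_fun_conv by blast
  let ?w = "map f [0..<Suc k]"
  have w: "vwalk ?w (with_proj G)"
    using f assms(1) by (intro vwalk_of_relpow_fun) auto
  show ?thesis
  proof
    show "vpath (vwalk_to_vpath ?w) (with_proj G)" by (rule vwalk_to_vpath_vpath[OF w])
    show "hd (vwalk_to_vpath ?w) = x"
      using f(1) by (simp add: vwalk_to_vpath_hd hd_map del: upt_Suc)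
    show "last (vwalk_to_vpath ?w) = y"
      using f(2) by (simp add: vwalk_to_vpath_last)
    show "vwalk_length (vwalk_to_vpath ?w) \<le> k"
      using length_vwalk_to_vpath_le[of ?w] by simp
  qed
qed

text \<open>A walk of length \<open>k\<close> from \<open>p ! a\<close> to \<open>p ! c\<close> can
  replace that segment of \<open>p\<close>. The result joins the ends of \<open>p\<close>, so it
  cannot be shorter than \<open>p\<close>.\<close>

lemma (in pair_wf_digraph) shortest_path_imp_between:
  assumes p: "shortest_path G p" and "a \<le> b" "b \<le> c" "c < length p"
  shows "between (parcs G) (p ! a) (p ! b) (p ! c)"
  unfolding between_def
proof (intro exI conjI allI impI)
  have w: "vwalk p (with_proj G)" using p by (auto simp: shortest_path_def)
  then have ne: "p \<noteq> []" by auto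
  show "(p ! a, p ! b) \<in> parcs G ^^ (b - a)" "(p ! b, p ! c) \<in> parcs G ^^ (c - b)"
    using vwalk_nth_relpow[OF w] assms by auto
  fix k assume k: "(p ! a, p ! c) \<in> parcs G ^^ k"
  let ?e = "length p - 1"
  have "(p ! 0, p ! a) \<in> parcs G ^^ a" "(p ! c, p ! ?e) \<in> parcs G ^^ (?e - c)"
    using vwalk_nth_relpow[OF w, of 0 a] vwalk_nth_relpow[OF w, of c ?e] assms by auto
  with k have "(p ! 0, p ! ?e) \<in> parcs G ^^ (a + k + (?e - c))"
    by (blast intro: relpow_trans)
  then have "(hd p, last p) \<in> parcs G ^^ (a + k + (?e - c))"
    using ne by (simp add: hd_conv_nth last_conv_nth)
  moreover have "hd p \<in> pverts G" using w ne by (auto simp: vwalk_with_proj_nth)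
  ultimately obtain q where "vpath q (with_proj G)" "hd q = hd p" "last q = last p"
    "vwalk_length q \<le> a + k + (?e - c)"
    using relpow_imp_vpath by blast
  with p have "vwalk_length p \<le> a + k + (?e - c)"
    unfolding shortest_path_def by (meson order_trans)
  then show "b - a + (c - b) \<le> k" using assms by simp
qed

text \<open>Concatenating the walks of lengths \<open>i\<close> and \<open>j\<close> gives a walk of
  the least possible length, which therefore repeats no vertex and is a shortest path through
  \<open>y\<close>.\<close>

lemma (in pair_wf_digraph) between_imp_shortest_path:
  assumes x: "x \<in> pverts G" and "between (parcs G) x y z"
  obtains p where "shortest_path G p" "{x, y, z} \<subseteq> set p"
proof -
  obtain i j where xy: "(x, y) \<in> parcs G ^^ i" and yz: "(y, z) \<in> parcs G ^^ j"
    and min: "\<And>k. (x, z) \<in> parcs G ^^ k \<Longrightarrow> i + j \<le> k"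
    using assms(2) unfolding between_def by blast
  obtain f where f: "f 0 = x" "f i = y" "\<And>m. m < i \<Longrightarrow> (f m, f (Suc m)) \<in> parcs G"
    using xy unfolding relpow_fun_conv by blast
  obtain g where g: "g 0 = y" "g j = z" "\<And>m. m < j \<Longrightarrow> (g m, g (Suc m)) \<in> parcs G"
    using yz unfolding relpow_fun_conv by blast
  define h where "h m = (if m \<le> i then f m else g (m - i))" for m
  have h0: "h 0 = x" and hi: "h i = y" and hij: "h (i + j) = z"
    using f g by (auto simp: h_def)
  have step: "(h m, h (Suc m)) \<in> parcs G" if "m < i + j" for m
  proof (cases "m < i")
    case True then show ?thesis using f(3) by (simp add: h_def)
  next
    case False
    then have "h m = g (m - i)" "h (Suc m) = g (Suc (m - i))"
      using f(2) g(1) by (auto simp: h_def Suc_diff_le)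
    then show ?thesis using g(3)[of "m - i"] that False by simp
  qed
  define p where "p = map h [0..<Suc (i + j)]"
  have len: "length p = Suc (i + j)" by (simp add: p_def)
  have nth: "p ! m = h m" if "m \<le> i + j" for m
    using that by (simp add: p_def del: upt_Suc)
  have w: "vwalk p (with_proj G)"
    unfolding p_def using h0 x step by (intro vwalk_of_relpow_fun) auto
  \<comment> \<open>A vertex met twice would allow the part between the two visits to be cut out,
    leaving a walk from \<open>x\<close> to \<open>z\<close> of length below
    \<open>i + j\<close>.\<close>
  have inj: False if "a < b" "b \<le> i + j" "h a = h b" for a b
  proof -
    have "(x, h a) \<in> parcs G ^^ a" "(h b, z) \<in> parcs G ^^ (i + j - b)"
      using vwalk_nth_relpow[OF w, of 0 a] vwalk_nth_relpow[OF w, of b "i + j"] that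
      by (auto simp: len nth h0 hij)
    then have "(x, z) \<in> parcs G ^^ (a + (i + j - b))"
      using that(3) by (auto intro: relpow_trans)
    from min[OF this] show False using that by simp
  qed
  have "distinct p"
    unfolding distinct_conv_nth len using inj by (metis less_Suc_eq_le linorder_neqE_nat nth)
  with w have "vpath p (with_proj G)" by auto
  moreover have "vwalk_length p \<le> vwalk_length q"
    if q: "vpath q (with_proj G)" "hd q = hd p" "last q = last p" for q
  proof -
    have ne: "q \<noteq> []" using q(1) by auto
    have "hd p = x" "last p = z"
      using nth len h0 hij by (auto simp: hd_conv_nth last_conv_nth simp flip: length_greater_0_conv)
    then have "(x, z) \<in> parcs G ^^ (length q - 1)"
      using vwalk_nth_relpow[of q G 0 "length q - 1"] q ne
      by (auto simp: hd_conv_nth last_conv_nth vpath_def)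
    from min[OF this] show ?thesis by (simp add: len)
  qed
  ultimately have "shortest_path G p" by (simp add: shortest_path_def)
  moreover have "{x, y, z} \<subseteq> set p"
    using h0 hi hij unfolding p_def by (auto simp del: upt_Suc simp: image_iff)
  ultimately show ?thesis using that by blast
qed

text \<open>Lying on a common shortest path is symmetric in the three vertices, while
  \<open>between\<close> singles out the middle one; ranging over all ordered triples absorbs the
  difference.\<close>

lemma (in pair_wf_digraph) general_position_set_iff:
  "general_position_set G S \<longleftrightarrow> S \<subseteq> pverts G \<and>
    \<not> (\<exists>x\<in>S. \<exists>y\<in>S. \<exists>z\<in>S. x \<noteq> y \<and> x \<noteq> z \<and> y \<noteq> z \<and> between (parcs G) x y z)"
proof (cases "S \<subseteq> pverts G")
  case True
  have "\<exists>x\<in>S. \<exists>y\<in>S. \<exists>z\<in>S. x \<noteq> y \<and> x \<noteq> z \<and> y \<noteq> z \<and> between (parcs G) x y z"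
    if S: "x \<in> S" "y \<in> S" "z \<in> S" "x \<noteq> y" "x \<noteq> z" "y \<noteq> z"
      and p: "shortest_path G p" "{x, y, z} \<subseteq> set p" for x y z p
  proof -
    obtain a b c where abc: "p ! a = x" "p ! b = y" "p ! c = z"
      "a < length p" "b < length p" "c < length p"
      using p(2) by (auto simp: in_set_conv_nth)
    note btw = shortest_path_imp_between[OF p(1)]
    consider "a \<le> b \<and> b \<le> c" | "a \<le> c \<and> c \<le> b" | "b \<le> a \<and> a \<le> c"
      | "b \<le> c \<and> c \<le> a" | "c \<le> a \<and> a \<le> b" | "c \<le> b \<and> b \<le> a" by linarith
    then show ?thesis
      using S abc btw[of a b c] btw[of a c b] btw[of b a c] btw[of b c a] btw[of c a b]
        btw[of c b a] by cases metis+
  qed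
  moreover have "\<exists>p. shortest_path G p \<and> {x, y, z} \<subseteq> set p"
    if "x \<in> S" "between (parcs G) x y z" for x y z
    using that True between_imp_shortest_path by blast
  ultimately show ?thesis unfolding general_position_set_def by meson
qed (simp add: general_position_set_def)

section \<open>General position in the lexicographic product\<close>

lemma parcs_lexicographic_product:
  "((g, h), (g', h')) \<in> parcs (lexicographic_product G H) \<longleftrightarrow>
    g \<in> pverts G \<and> h \<in> pverts H \<and> g' \<in> pverts G \<and> h' \<in> pverts H \<and>
    ((g, g') \<in> parcs G \<or> g = g' \<and> (h, h') \<in> parcs H)"
  by (auto simp: lexicographic_product_def)

lemma pverts_lexicographic_product:
  "pverts (lexicographic_product G H) = pverts G \<times> pverts H"
  by (simp add: lexicographic_product_def)

lemma pair_wf_digraph_lexicographic_product: "pair_wf_digraph (lexicographic_product G H)"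
  by unfold_locales (auto simp: lexicographic_product_def)

text \<open>A step inside a fibre projects to no step at all, so the projected walk can only become
  shorter.\<close>

lemma lexicographic_product_relpow_fst:
  assumes "(u, v) \<in> parcs (lexicographic_product G H) ^^ k"
  shows "\<exists>k'\<le>k. (fst u, fst v) \<in> parcs G ^^ k'"
  using assms
proof (induction k arbitrary: v)
  case (Suc k)
  then obtain w where "(u, w) \<in> parcs (lexicographic_product G H) ^^ k"
    and wv: "(w, v) \<in> parcs (lexicographic_product G H)" by auto
  with Suc.IH obtain k' where k': "k' \<le> k" "(fst u, fst w) \<in> parcs G ^^ k'" by blast
  have "fst w = fst v \<or> (fst w, fst v) \<in> parcs G"
    using wv by (cases w; cases v) (auto simp: parcs_lexicographic_product)
  then show ?case
  proof
    assume "fst w = fst v" with k' show ?thesis by (auto intro!: exI[of _ k'])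
  next
    assume "(fst w, fst v) \<in> parcs G"
    with k' show ?thesis by (auto intro!: exI[of _ "Suc k'"])
  qed
qed auto

text \<open>An arc of \<open>G\<close> lifts to an arc between any two levels, so the lifted walk
  stays at level \<open>h\<close> and switches to \<open>h'\<close> in its last step. A walk without
  steps could not change level, hence \<open>Suc k\<close>.\<close>

lemma (in pair_wf_digraph) lexicographic_product_relpow_lift:
  assumes "(g, g') \<in> parcs G ^^ Suc k" "h \<in> pverts H" "h' \<in> pverts H"
  shows "((g, h), (g', h')) \<in> parcs (lexicographic_product G H) ^^ Suc k"
  using assms(1,3)
proof (induction k arbitrary: g' h')
  case 0
  then show ?case using assms(2) by (auto simp: parcs_lexicographic_product dest: in_arcsD1 in_arcsD2)
next
  case (Suc k)
  then obtain w where w: "(g, w) \<in> parcs G ^^ Suc k" "(w, g') \<in> parcs G" by auto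
  from Suc.IH[OF w(1) assms(2)]
  have "((g, h), (w, h)) \<in> parcs (lexicographic_product G H) ^^ Suc k" .
  moreover have "((w, h), (g', h')) \<in> parcs (lexicographic_product G H)"
    using w(2) Suc.prems assms(2) by (auto simp: parcs_lexicographic_product dest: in_arcsD1 in_arcsD2)
  ultimately show ?case by (meson relpow_Suc_I)
qed

lemma (in pair_wf_digraph) lexicographic_product_relpow_lift_neq:
  assumes "(fst u, fst v) \<in> parcs G ^^ k" "fst u \<noteq> fst v"
    "snd u \<in> pverts H" "snd v \<in> pverts H"
  shows "(u, v) \<in> parcs (lexicographic_product G H) ^^ k"
proof -
  obtain k' where "k = Suc k'" using assms by (cases k) auto
  then show ?thesis
    using lexicographic_product_relpow_lift[of "fst u" "fst v" k' "snd u" H "snd v"] assms by simp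
qed

text \<open>Walks between different fibres can be projected and lifted without gaining length, so
  distances agree with those in \<open>G\<close>. Two vertices of one fibre are adjacent twins:
  nothing lies strictly between them, and visiting one on the way from the other to a third vertex
  is a detour.\<close>

lemma (in pair_wf_digraph) between_lexicographic_product_complete:
  assumes H: "parcs H = {(u, v). (u, v) \<in> pverts H \<times> pverts H \<and> u \<noteq> v}"
    and V: "u \<in> pverts G \<times> pverts H" "v \<in> pverts G \<times> pverts H" "w \<in> pverts G \<times> pverts H"
    and d: "u \<noteq> v" "u \<noteq> w" "v \<noteq> w"
  shows "between (parcs (lexicographic_product G H)) u v w \<longleftrightarrow>
    fst u \<noteq> fst v \<and> fst u \<noteq> fst w \<and> fst v \<noteq> fst w \<and>
    between (parcs G) (fst u) (fst v) (fst w)"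
    (is "between ?P u v w \<longleftrightarrow> ?R")
proof
  have sV: "snd u \<in> pverts H" "snd v \<in> pverts H" "snd w \<in> pverts H" using V by auto
  {
    assume "between ?P u v w"
    then obtain i j where ij: "(u, v) \<in> ?P ^^ i" "(v, w) \<in> ?P ^^ j"
      and min: "\<And>k. (u, w) \<in> ?P ^^ k \<Longrightarrow> i + j \<le> k"
      unfolding between_def by blast
    have pos: "i > 0" "j > 0" using ij d by (auto intro: Nat.gr0I)
    obtain i' where i': "i' \<le> i" "(fst u, fst v) \<in> parcs G ^^ i'"
      using lexicographic_product_relpow_fst[OF ij(1)] by blast
    obtain j' where j': "j' \<le> j" "(fst v, fst w) \<in> parcs G ^^ j'"
      using lexicographic_product_relpow_fst[OF ij(2)] by blast
    \<comment> \<open>Completeness of \<open>H\<close> makes two vertices of one fibre adjacent,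
      whereas \<open>i + j\<close> is at least 2.\<close>
    have uw: "fst u \<noteq> fst w"
    proof
      assume "fst u = fst w"
      then have "(u, w) \<in> ?P ^^ 1"
        using V d(2) by (cases u; cases w) (auto simp: parcs_lexicographic_product H)
      from min[OF this] pos show False by simp
    qed
    \<comment> \<open>If \<open>v\<close> were a twin of \<open>u\<close>, the projected walk from
      \<open>v\<close> to \<open>w\<close> would lift to one starting at \<open>u\<close>, saving
      the steps from \<open>u\<close> to \<open>v\<close>.\<close>
    have uv: "fst u \<noteq> fst v"
    proof
      assume "fst u = fst v"
      then have "(u, w) \<in> ?P ^^ j'"
        using lexicographic_product_relpow_lift_neq j'(2) uw sV by metis
      from min[OF this] pos j'(1) show False by simp
    qed
    have vw: "fst v \<noteq> fst w"
    proof
      assume "fst v = fst w"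
      then have "(u, w) \<in> ?P ^^ i'"
        using lexicographic_product_relpow_lift_neq i'(2) uw sV by metis
      from min[OF this] pos i'(1) show False by simp
    qed
    have "i' + j' \<le> k" if "(fst u, fst w) \<in> parcs G ^^ k" for k
      using min[OF lexicographic_product_relpow_lift_neq[OF that uw sV(1,3)]] i'(1) j'(1) by simp
    then show ?R using uw uv vw i'(2) j'(2) unfolding between_def by blast
  }
  {
    assume R: ?R
    then obtain i j where ij: "(fst u, fst v) \<in> parcs G ^^ i" "(fst v, fst w) \<in> parcs G ^^ j"
      and min: "\<And>k. (fst u, fst w) \<in> parcs G ^^ k \<Longrightarrow> i + j \<le> k"
      unfolding between_def by blast
    have "(u, v) \<in> ?P ^^ i" "(v, w) \<in> ?P ^^ j"
      using lexicographic_product_relpow_lift_neq ij R sV by blast+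
    moreover have "i + j \<le> k" if "(u, w) \<in> ?P ^^ k" for k
      using lexicographic_product_relpow_fst[OF that] min order_trans by blast
    ultimately show "between ?P u v w" unfolding between_def by blast
  }
qed

text \<open>A forbidden triple of the product projects to three distinct vertices, and distinct
  projections come from distinct members of \<open>S\<close>; so forbidden triples correspond in
  both directions.\<close>

lemma (in pair_wf_digraph) general_position_set_lexicographic_product_complete:
  assumes H: "parcs H = {(u, v). (u, v) \<in> pverts H \<times> pverts H \<and> u \<noteq> v}"
  shows "general_position_set (lexicographic_product G H) S \<longleftrightarrow>
    S \<subseteq> UNIV \<times> pverts H \<and> general_position_set G (fst ` S)"
proof -
  interpret P: pair_wf_digraph "lexicographic_product G H"
    by (rule pair_wf_digraph_lexicographic_product)
  have sub: "S \<subseteq> pverts G \<times> pverts H \<longleftrightarrow> S \<subseteq> UNIV \<times> pverts H \<and> fst ` S \<subseteq> pverts G"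
    by force
  show ?thesis
  proof (cases "S \<subseteq> pverts G \<times> pverts H")
    case True
    then have btw: "between (parcs (lexicographic_product G H)) u v w \<longleftrightarrow>
        fst u \<noteq> fst v \<and> fst u \<noteq> fst w \<and> fst v \<noteq> fst w \<and>
        between (parcs G) (fst u) (fst v) (fst w)"
      if "u \<in> S" "v \<in> S" "w \<in> S" "u \<noteq> v" "u \<noteq> w" "v \<noteq> w" for u v w
      using between_lexicographic_product_complete[OF H] that by blast
    have "(\<exists>u\<in>S. \<exists>v\<in>S. \<exists>w\<in>S. u \<noteq> v \<and> u \<noteq> w \<and> v \<noteq> w \<and>
          between (parcs (lexicographic_product G H)) u v w) \<longleftrightarrow>
        (\<exists>u\<in>S. \<exists>v\<in>S. \<exists>w\<in>S. fst u \<noteq> fst v \<and> fst u \<noteq> fst w \<and> fst v \<noteq> fst w \<and>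
          between (parcs G) (fst u) (fst v) (fst w))"
      using btw by (intro bex_cong refl) metis
    then show ?thesis
      using True sub unfolding general_position_set_iff P.general_position_set_iff
        pverts_lexicographic_product by simp
  next
    case False
    then show ?thesis
      using sub unfolding general_position_set_iff P.general_position_set_iff
        pverts_lexicographic_product by auto
  qed
qed

section \<open>The avoidance game of a set family\<close>

text \<open>Legality does not depend on the order of selection, so a position is reduced to its set.
  When \<open>F\<close> is general position, \<open>F\<close> itself confines \<open>v\<close> to
  the vertices.\<close>

definition moves :: "('a set \<Rightarrow> bool) \<Rightarrow> 'a set \<Rightarrow> 'a set" where
  "moves F S = {v. v \<notin> S \<and> F (insert v S)}"

text \<open>\<open>B_forces F X S\<close>: player B can force the game to end after finitely many moves with A making
  the last one, starting from the selected set \<open>S\<close> with \<open>X\<close> to move.\<close>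

inductive B_forces :: "('a set \<Rightarrow> bool) \<Rightarrow> player \<Rightarrow> 'a set \<Rightarrow> bool" for F where
  A_moves: "moves F S \<noteq> {} \<Longrightarrow> (\<And>v. v \<in> moves F S \<Longrightarrow> B_forces F Player_B (insert v S))
    \<Longrightarrow> B_forces F Player_A S"
| B_stuck: "moves F S = {} \<Longrightarrow> B_forces F Player_B S"
| B_moves: "v \<in> moves F S \<Longrightarrow> B_forces F Player_A (insert v S) \<Longrightarrow> B_forces F Player_B S"

lemma B_forces_A_iff:
  "B_forces F Player_A S \<longleftrightarrow>
    moves F S \<noteq> {} \<and> (\<forall>v\<in>moves F S. B_forces F Player_B (insert v S))"
  by (subst B_forces.simps) auto

lemma B_forces_B_iff:
  "B_forces F Player_B S \<longleftrightarrow>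
    moves F S = {} \<or> (\<exists>v\<in>moves F S. B_forces F Player_A (insert v S))"
  by (subst B_forces.simps) auto

section \<open>From positions as lists to positions as sets\<close>

lemma legal_moves_eq: "legal_moves G xs = moves (general_position_set G) (set xs)"
  by (auto simp: legal_moves_def moves_def general_position_set_def)

lemma to_move_snoc: "to_move (xs @ [v]) = opponent (to_move xs)"
  by (simp add: to_move_def)

text \<open>As a least fixed point it has only well-founded derivations, so termination of the game
  is built in. No rule covers A to move without a legal move, because A did not select last
  there.\<close>

inductive strategy_wins :: "'a pair_pre_digraph \<Rightarrow> ('a list \<Rightarrow> 'a) \<Rightarrow> 'a list \<Rightarrow> bool"
  for G \<sigma> where
  A_moves: "to_move xs = Player_A \<Longrightarrow> \<not> game_over G xs \<Longrightarrow>
    (\<And>v. v \<in> legal_moves G xs \<Longrightarrow> strategy_wins G \<sigma> (xs @ [v])) \<Longrightarrow> strategy_wins G \<sigma> xs"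
| B_stuck: "to_move xs = Player_B \<Longrightarrow> game_over G xs \<Longrightarrow> strategy_wins G \<sigma> xs"
| B_moves: "to_move xs = Player_B \<Longrightarrow> \<sigma> xs \<in> legal_moves G xs \<Longrightarrow>
    strategy_wins G \<sigma> (xs @ [\<sigma> xs]) \<Longrightarrow> strategy_wins G \<sigma> xs"

text \<open>A derivation consults the strategy only at \<open>xs\<close> and its extensions.\<close>

lemma strategy_wins_cong:
  assumes "strategy_wins G \<sigma> xs" "\<And>zs. \<tau> (xs @ zs) = \<sigma> (xs @ zs)"
  shows "strategy_wins G \<tau> xs"
  using assms
proof (induction xs rule: strategy_wins.induct)
  case (A_moves xs)
  have "strategy_wins G \<tau> (xs @ [v])" if "v \<in> legal_moves G xs" for v
    using that by (rule A_moves.IH) (simp add: A_moves.prems)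
  with A_moves.hyps(1,2) show ?case by (rule strategy_wins.A_moves)
next
  case (B_stuck xs)
  from B_stuck.hyps show ?case by (rule strategy_wins.B_stuck)
next
  case (B_moves xs)
  have "\<tau> xs = \<sigma> xs" using B_moves.prems[of "[]"] by simp
  with B_moves.hyps(2) B_moves.IH B_moves.prems
  have "\<tau> xs \<in> legal_moves G xs" "strategy_wins G \<tau> (xs @ [\<tau> xs])" by simp_all
  with B_moves.hyps(1) show ?case by (rule strategy_wins.B_moves)
qed

lemma strategy_wins_imp_B_forces:
  assumes "strategy_wins G \<sigma> xs"
  shows "B_forces (general_position_set G) (to_move xs) (set xs)"
  using assms
proof (induction xs rule: strategy_wins.induct)
  case (A_moves xs)
  then show ?case
    by (auto simp: B_forces_A_iff to_move_snoc game_over_def legal_moves_eq)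
next
  case (B_stuck xs)
  then show ?case by (auto simp: B_forces_B_iff game_over_def legal_moves_eq)
next
  case (B_moves xs)
  then show ?case by (auto simp: B_forces_B_iff to_move_snoc legal_moves_eq)
qed

text \<open>The strategies for the individual continuations are glued together along the history of the
  play. Choosing an arbitrary winning successor at each turn would not do: on an infinite graph it
  could postpone the end of the game forever.\<close>

lemma B_forces_imp_strategy_wins:
  assumes "B_forces (general_position_set G) X S" "set xs = S" "to_move xs = X"
  shows "\<exists>\<sigma>. strategy_wins G \<sigma> xs"
  using assms
proof (induction X S arbitrary: xs rule: B_forces.induct)
  case (A_moves S)
  have "\<exists>\<sigma>. strategy_wins G \<sigma> (xs @ [v])" if "v \<in> legal_moves G xs" for v
    using that A_moves by (auto simp: legal_moves_eq to_move_snoc)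
  then obtain s where s: "\<And>v. v \<in> legal_moves G xs \<Longrightarrow> strategy_wins G (s v) (xs @ [v])"
    by metis
  \<comment> \<open>Index \<open>length xs\<close> holds A's reply to \<open>xs\<close>, so every
    later position still shows which continuation is in use. At \<open>xs\<close> itself A moves and
    the value is never consulted.\<close>
  define \<sigma> where "\<sigma> ys = s (ys ! length xs) ys" for ys
  have "strategy_wins G \<sigma> (xs @ [v])" if "v \<in> legal_moves G xs" for v
    by (rule strategy_wins_cong[OF s[OF that]]) (simp add: \<sigma>_def)
  then have "strategy_wins G \<sigma> xs"
    using A_moves.hyps(1) A_moves.prems
    by (auto intro!: strategy_wins.A_moves[of xs] simp: game_over_def legal_moves_eq)
  then show ?case by blast
next
  case (B_stuck S)
  \<comment> \<open>No move remains to be prescribed, so an arbitrary strategy serves.\<close>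
  then have "strategy_wins G undefined xs"
    by (intro strategy_wins.B_stuck) (auto simp: game_over_def legal_moves_eq)
  then show ?case by blast
next
  case (B_moves v S)
  have "\<exists>\<tau>. strategy_wins G \<tau> (xs @ [v])"
    using B_moves.prems by (intro B_moves.IH) (simp_all add: to_move_snoc)
  then obtain \<tau> where \<tau>: "strategy_wins G \<tau> (xs @ [v])" ..
  \<comment> \<open>The position \<open>xs\<close> does not extend \<open>xs @ [v]\<close>, so the
    update leaves the continuation intact.\<close>
  have "strategy_wins G (\<tau>(xs := v)) (xs @ [v])"
    by (rule strategy_wins_cong[OF \<tau>]) auto
  then have "strategy_wins G (\<tau>(xs := v)) xs"
    using B_moves.hyps(1) B_moves.prems
    by (auto intro: strategy_wins.B_moves[of xs] simp: legal_moves_eq)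
  then show ?case by blast
qed

section \<open>Strategies against all plays that follow them\<close>

lemma legal_play_snoc:
  "legal_play G (xs @ [v]) \<longleftrightarrow> legal_play G xs \<and> v \<in> legal_moves G xs"
  by (auto simp: legal_play_def less_Suc_eq nth_append)

lemma follows_snoc:
  "follows X \<sigma> (xs @ [v]) \<longleftrightarrow> follows X \<sigma> xs \<and> (to_move xs = X \<longrightarrow> v = \<sigma> xs)"
  by (auto simp: follows_def less_Suc_eq nth_append)

text \<open>The play descends through the derivation for the empty position: its premises cover all
  moves of A, and the moves of B are the prescribed ones.\<close>

lemma strategy_wins_along_play:
  assumes "strategy_wins G \<sigma> []" "legal_play G xs" "follows Player_B \<sigma> xs"
  shows "strategy_wins G \<sigma> xs"
  using assms(2,3)
proof (induction xs rule: rev_induct)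
  case Nil
  then show ?case using assms(1) by simp
next
  case (snoc v xs)
  then have v: "v \<in> legal_moves G xs" "to_move xs = Player_B \<longrightarrow> v = \<sigma> xs"
    and "strategy_wins G \<sigma> xs"
    by (auto simp: legal_play_snoc follows_snoc)
  from this(3) show ?case
    using v by cases (auto simp: game_over_def)
qed

text \<open>An infinite play following \<open>\<sigma>\<close> would pass from each position of the
  derivation to one of its premises forever, against well-foundedness.\<close>

lemma strategy_wins_finite:
  assumes "strategy_wins G \<sigma> xs" "xs = map f [0..<length xs]"
    and "\<forall>k. legal_play G (map f [0..<k]) \<and> follows Player_B \<sigma> (map f [0..<k])"
  shows False
  using assms(1,2)
proof (induction xs rule: strategy_wins.induct)
  case (A_moves xs)
  have eq: "map f [0..<Suc (length xs)] = xs @ [f (length xs)]"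
    using A_moves.prems by simp
  have "legal_play G (xs @ [f (length xs)])"
    using assms(3) eq by metis
  then show ?case
    using A_moves.IH[of "f (length xs)"] eq by (simp add: legal_play_snoc del: upt_Suc)
next
  case (B_stuck xs)
  have "legal_play G (xs @ [f (length xs)])"
    using assms(3) B_stuck.prems by (metis upt_Suc_append list.simps(8,9) map_append zero_le)
  then show ?case using B_stuck by (simp add: legal_play_snoc game_over_def)
next
  case (B_moves xs)
  have eq: "map f [0..<Suc (length xs)] = xs @ [f (length xs)]"
    using B_moves.prems by simp
  have "follows Player_B \<sigma> (xs @ [f (length xs)])"
    using assms(3) eq by metis
  then have "f (length xs) = \<sigma> xs"
    using B_moves.hyps by (simp add: follows_snoc)
  then show ?case
    using B_moves.IH eq by (simp del: upt_Suc)
qed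

lemma selected_last_iff:
  "selected_last X xs \<longleftrightarrow> xs \<noteq> [] \<and> to_move xs = opponent X"
  by (cases xs rule: rev_cases; cases X; cases "to_move (butlast xs)")
    (auto simp: selected_last_def to_move_snoc)

text \<open>A derivation covers all plays that follow \<open>\<sigma>\<close>. Conversely, a
  position reached by following a winning \<open>\<sigma>\<close> and lacking a derivation has a
  successor of the same kind; iterating this yields an infinite play, which a winning strategy
  excludes.\<close>

lemma avoidance_winning_strategy_iff_strategy_wins:
  "avoidance_winning_strategy G Player_B \<sigma> \<longleftrightarrow> strategy_wins G \<sigma> []"
proof
  assume win: "strategy_wins G \<sigma> []"
  have "\<sigma> xs \<in> legal_moves G xs"
    if "legal_play G xs" "follows Player_B \<sigma> xs" "\<not> game_over G xs" "to_move xs = Player_B" for xs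
    using strategy_wins_along_play[OF win that(1,2)] that(3,4) by cases auto
  moreover have "selected_last Player_A xs"
    if "legal_play G xs" "follows Player_B \<sigma> xs" "game_over G xs" for xs
  proof -
    from strategy_wins_along_play[OF win that(1,2)] have "to_move xs = Player_B"
      using that(3) by cases (auto simp: game_over_def)
    then show ?thesis by (auto simp: selected_last_iff to_move_def)
  qed
  moreover have "\<not> (\<exists>f. \<forall>k. legal_play G (map f [0..<k]) \<and> follows Player_B \<sigma> (map f [0..<k]))"
    using strategy_wins_finite[OF win, unfolded list.size upt_0 list.map] by blast
  ultimately show "avoidance_winning_strategy G Player_B \<sigma>"
    unfolding avoidance_winning_strategy_def opponent.simps by blast
next
  assume win: "avoidance_winning_strategy G Player_B \<sigma>"
  have legal: "\<sigma> xs \<in> legal_moves G xs"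
    if "legal_play G xs" "follows Player_B \<sigma> xs" "\<not> game_over G xs" "to_move xs = Player_B" for xs
    using win that unfolding avoidance_winning_strategy_def by blast
  have over: "to_move xs = Player_B"
    if "legal_play G xs" "follows Player_B \<sigma> xs" "game_over G xs" for xs
    using win that unfolding avoidance_winning_strategy_def opponent.simps selected_last_iff by blast
  show "strategy_wins G \<sigma> []"
  proof (rule ccontr)
    assume lose: "\<not> strategy_wins G \<sigma> []"
    define bad where "bad xs \<longleftrightarrow> legal_play G xs \<and> follows Player_B \<sigma> xs \<and>
      \<not> strategy_wins G \<sigma> xs" for xs
    have ex: "\<exists>v. bad (xs @ [v])" if xs: "bad xs" for xs
    proof (cases "to_move xs")
      case Player_A
      have "\<not> game_over G xs"
        using over[of xs] that Player_A by (auto simp: bad_def)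
      then obtain v where "v \<in> legal_moves G xs" "\<not> strategy_wins G \<sigma> (xs @ [v])"
        using xs Player_A strategy_wins.A_moves[of xs G \<sigma>] unfolding bad_def by blast
      then show ?thesis
        using that Player_A by (auto simp: bad_def legal_play_snoc follows_snoc)
    next
      case Player_B
      have "\<not> game_over G xs"
        using that Player_B strategy_wins.B_stuck[of xs G \<sigma>] by (auto simp: bad_def)
      then have "\<sigma> xs \<in> legal_moves G xs"
        using legal[of xs] that Player_B by (auto simp: bad_def)
      then show ?thesis
        using that Player_B strategy_wins.B_moves[of xs \<sigma> G]
        by (auto simp: bad_def legal_play_snoc follows_snoc)
    qed
    \<comment> \<open>Bad successors are chosen recursively; \<open>f\<close> lists the chosen
      moves, so its prefixes are the positions \<open>play k\<close>.\<close>
    define next_move where "next_move xs = (SOME v. bad (xs @ [v]))" for xs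
    define play where "play = rec_nat [] (\<lambda>_ xs. xs @ [next_move xs])"
    define f where "f k = next_move (play k)" for k
    have play: "play k = map f [0..<k]" for k
      by (induction k) (simp_all add: play_def f_def)
    have "bad (play k)" for k
    proof (induction k)
      case 0
      then show ?case
        using lose by (simp add: play_def bad_def legal_play_def follows_def)
    next
      case (Suc k)
      then show ?case
        using someI_ex[OF ex[OF Suc]] by (simp add: play_def next_move_def)
    qed
    then show False
      using win unfolding avoidance_winning_strategy_def bad_def play by blast
  qed
qed

lemma wins_avoidance_game_iff_B_forces:
  "wins_avoidance_game Player_B G \<longleftrightarrow> B_forces (general_position_set G) Player_A {}"
  unfolding wins_avoidance_game_def avoidance_winning_strategy_iff_strategy_wins
  using strategy_wins_imp_B_forces[of G _ "[]"]
    B_forces_imp_strategy_wins[of G Player_A "{}" "[]"]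
  by (auto simp: to_move_def)

section \<open>Blowing up every element into a fibre\<close>

text \<open>\<open>Domain S\<close> is the set of opened fibres. With general position in
  \<open>G\<close> for \<open>F\<close> and the vertices of a complete graph for \<open>K\<close>,
  this is general position in the product.\<close>

definition blow_up :: "('a set \<Rightarrow> bool) \<Rightarrow> 'b set \<Rightarrow> ('a \<times> 'b) set \<Rightarrow> bool" where
  "blow_up F K S \<longleftrightarrow> S \<subseteq> UNIV \<times> K \<and> F (Domain S)"

text \<open>The invariant of the pairing: one place opened the fibre, the others came in pairs. For
  odd \<open>card K\<close> it leaves evenly many free places in each opened fibre.\<close>

definition odd_fibres :: "('a \<times> 'b) set \<Rightarrow> bool" where
  "odd_fibres S \<longleftrightarrow> finite S \<and> (\<forall>g\<in>Domain S. odd (card (S `` {g})))"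

section \<open>Legal moves and fibre parities in the blow-up\<close>

lemma insert_Image_singleton:
  "insert (a, b) S `` {g} = (if g = a then insert b (S `` {g}) else S `` {g})"
  by auto

lemma moves_blow_up_new:
  assumes "blow_up F K S" "g \<notin> Domain S"
  shows "(g, h) \<in> moves (blow_up F K) S \<longleftrightarrow> h \<in> K \<and> g \<in> moves F (Domain S)"
  using assms by (auto simp: moves_def blow_up_def)

text \<open>A place in an opened fibre leaves \<open>Domain S\<close> unchanged, so only its being
  free matters.\<close>

lemma moves_blow_up_old:
  assumes "blow_up F K S" "g \<in> Domain S"
  shows "(g, h) \<in> moves (blow_up F K) S \<longleftrightarrow> h \<in> K \<and> (g, h) \<notin> S"
  using assms by (auto simp: moves_def blow_up_def insert_absorb)

lemma moves_blow_up_maximal: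
  fixes S :: "('a \<times> 'b) set"
  assumes "blow_up F K S" "moves F (Domain S) = {}"
  shows "moves (blow_up F K) S = Domain S \<times> K - S"
proof (rule set_eqI)
  fix v :: "'a \<times> 'b"
  obtain g h where [simp]: "v = (g, h)" by fastforce
  show "v \<in> moves (blow_up F K) S \<longleftrightarrow> v \<in> Domain S \<times> K - S"
    using moves_blow_up_new[OF assms(1), of g h] moves_blow_up_old[OF assms(1), of g h] assms(2)
    by (cases "g \<in> Domain S") simp_all
qed

lemma blow_up_insert: "v \<in> moves (blow_up F K) S \<Longrightarrow> blow_up F K (insert v S)"
  by (simp add: moves_def)

lemma odd_fibres_insert_new:
  assumes "odd_fibres S" "g \<notin> Domain S"
  shows "odd_fibres (insert (g, h) S)"
proof -
  have "S `` {g} = {}" using assms(2) by auto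
  then show ?thesis using assms by (auto simp: odd_fibres_def insert_Image_singleton)
qed

lemma odd_fibres_insert_two:
  assumes "odd_fibres S" "g \<in> Domain S" "(g, h) \<notin> S" "(g, h') \<notin> S" "h \<noteq> h'"
  shows "odd_fibres (insert (g, h') (insert (g, h) S))"
proof -
  have "finite (S `` {g})" using assms(1) by (auto simp: odd_fibres_def)
  then have "card (insert h' (insert h (S `` {g}))) = card (S `` {g}) + 2"
    using assms by simp
  then show ?thesis using assms by (auto simp: odd_fibres_def insert_Image_singleton)
qed

text \<open>The number of free places in an opened fibre is odd minus odd, hence even, so a free
  place is never the only one.\<close>

lemma odd_fibres_partner:
  assumes "odd_fibres S" "blow_up F K S" "finite K" "odd (card K)"
    and "g \<in> Domain S" "h \<in> K" "(g, h) \<notin> S"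
  obtains h' where "h' \<in> K" "h' \<noteq> h" "(g, h') \<notin> S"
proof -
  have "S `` {g} \<subseteq> K" using assms(2) by (auto simp: blow_up_def)
  then have "card (K - S `` {g}) = card K - card (S `` {g})" "card (S `` {g}) \<le> card K"
    using assms(3) by (auto intro: card_Diff_subset card_mono finite_subset)
  then have "even (card (K - S `` {g}))"
    using assms(1,4,5) by (simp add: odd_fibres_def)
  then have "K - S `` {g} \<noteq> {h}" by auto
  then show ?thesis using that assms(6,7) by blast
qed

text \<open>Each opened fibre contributes an even number of free places to the sum.\<close>

lemma even_card_remaining:
  assumes "odd_fibres S" "blow_up F K S" "finite K" "odd (card K)"
  shows "even (card (Domain S \<times> K - S))"
proof -
  have fin: "finite (Domain S)" using assms(1) by (simp add: odd_fibres_def finite_Domain)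
  have "even (card (K - S `` {g}))" if "g \<in> Domain S" for g
  proof -
    have "S `` {g} \<subseteq> K" using assms(2) by (auto simp: blow_up_def)
    then have "card (K - S `` {g}) = card K - card (S `` {g})" "card (S `` {g}) \<le> card K"
      using assms(3) by (auto intro: card_Diff_subset card_mono finite_subset)
    then show ?thesis using that assms(1,4) by (simp add: odd_fibres_def)
  qed
  moreover have "Domain S \<times> K - S = (SIGMA g:Domain S. K - S `` {g})" by auto
  ultimately show ?thesis
    using fin assms(3) by (simp add: dvd_sum)
qed

lemma card_remaining_insert_old:
  assumes "finite S" "finite K" "fst v \<in> Domain S" "snd v \<in> K" "v \<notin> S"
  shows "card (Domain S \<times> K - S) = Suc (card (Domain (insert v S) \<times> K - insert v S))"
proof -
  have "Domain (insert v S) = Domain S" using assms(3) by (cases v) auto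
  moreover have "Domain S \<times> K - insert v S = (Domain S \<times> K - S) - {v}" by auto
  moreover have "v \<in> Domain S \<times> K - S" "finite (Domain S \<times> K - S)"
    using assms by (auto simp: mem_Times_iff finite_Domain)
  ultimately show ?thesis by (simp only: card_Suc_Diff1)
qed

text \<open>Once the projection is maximal, the remaining moves are exactly the free places of the opened
  fibres, so their parity decides the game.\<close>

lemma B_forces_blow_up_maximal:
  assumes "finite K" "finite S" "blow_up F K S" "moves F (Domain S) = {}"
  shows "B_forces (blow_up F K) X S \<longleftrightarrow> (X = Player_A \<longleftrightarrow> odd (card (Domain S \<times> K - S)))"
  using assms(2-4)
proof (induction "card (Domain S \<times> K - S)" arbitrary: S X)
  case 0
  \<comment> \<open>Infinite sets also have \<open>card\<close> 0, so finiteness is what turns the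
    base case into emptiness.\<close>
  have fin: "finite (Domain S \<times> K - S)" using 0 assms(1) by (simp add: finite_Domain)
  have M: "moves (blow_up F K) S = Domain S \<times> K - S"
    by (rule moves_blow_up_maximal[OF 0(3) 0(4)])
  with 0(1) fin have "moves (blow_up F K) S = {}" by simp
  then show ?case
    using B_forces_A_iff[of "blow_up F K" S] B_forces_B_iff[of "blow_up F K" S] 0(1)
    by (cases X) simp_all
next
  case (Suc m)
  have M: "moves (blow_up F K) S = Domain S \<times> K - S"
    by (rule moves_blow_up_maximal[OF Suc(4) Suc(5)])
  have ne: "Domain S \<times> K - S \<noteq> {}" using Suc(2) by (metis card.empty nat.distinct(1))
  have "B_forces (blow_up F K) Y (insert v S) \<longleftrightarrow> (Y = Player_A \<longleftrightarrow> odd m)"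
    if v: "v \<in> Domain S \<times> K - S" for v Y
  proof -
    have D: "Domain (insert v S) = Domain S" using v by (cases v) auto
    have c: "m = card (Domain (insert v S) \<times> K - insert v S)"
      using card_remaining_insert_old[of S K v] v Suc(2,3) assms(1) by (auto simp: mem_Times_iff)
    show ?thesis
      using Suc(1)[OF c, of Y] Suc(3,5) c D blow_up_insert[of v F K S] M v by simp
  qed
  then show ?case
    using B_forces_A_iff[of "blow_up F K" S] B_forces_B_iff[of "blow_up F K" S] ne M
    unfolding Suc(2)[symmetric] by (cases X) auto
qed

text \<open>B answers a move in an opened fibre by a move in the same fibre, and a move in a new fibre
  as in the original game.\<close>

lemma B_forces_blow_up:
  assumes K: "finite K" "odd (card K)"
    and "B_forces F X P" "odd_fibres S" "blow_up F K S" "Domain S = P"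
  shows "B_forces (blow_up F K) X S"
  using assms(3-6)
proof (induction X P arbitrary: S rule: B_forces.induct)
  case (A_moves P)
  from A_moves.prems show ?case
  \<comment> \<open>A pair of moves in an opened fibre leaves \<open>P\<close> unchanged, out of
    reach of the outer induction. The inner one counts the free places, which such a pair lowers by
    two.\<close>
  proof (induction "card (Domain S \<times> K - S)" arbitrary: S rule: less_induct)
    case less
    obtain h where h: "h \<in> K" using K by fastforce
    obtain g where "g \<in> moves F P" using A_moves.hyps(1) by blast
    then have "(g, h) \<in> moves (blow_up F K) S"
      using moves_blow_up_new[OF less.prems(2), of g h] less.prems(3) h by (auto simp: moves_def)
    then have ne: "moves (blow_up F K) S \<noteq> {}" by blast
    have "B_forces (blow_up F K) Player_B (insert v S)" if v: "v \<in> moves (blow_up F K) S" for v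
    proof (cases "fst v \<in> P")
      case False
      then show ?thesis
        using A_moves.IH[of "fst v" "insert v S"] moves_blow_up_new[OF less.prems(2), of "fst v" "snd v"]
          odd_fibres_insert_new[OF less.prems(1), of "fst v" "snd v"] v less.prems(3)
          blow_up_insert[OF v] Domain_insert[of "fst v" "snd v" S]
        by simp
    next
      case True
      obtain g h where [simp]: "v = (g, h)" by fastforce
      have g: "g \<in> Domain S" and h: "h \<in> K" "(g, h) \<notin> S"
        using True less.prems(3) v moves_blow_up_old[OF less.prems(2), of g h] by auto
      obtain h' where h': "h' \<in> K" "h' \<noteq> h" "(g, h') \<notin> S"
        by (rule odd_fibres_partner[OF less.prems(1,2) K g h])
      let ?T = "insert (g, h') (insert v S)"
      have D: "Domain (insert v S) = Domain S" "Domain ?T = Domain S" using g by auto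
      have mv: "(g, h') \<in> moves (blow_up F K) (insert v S)"
        using moves_blow_up_old[OF blow_up_insert[OF v], of g h'] h' D(1) g by auto
      have fin: "finite S" using less.prems(1) by (simp add: odd_fibres_def)
      have "card (Domain ?T \<times> K - ?T) < card (Domain S \<times> K - S)"
        using card_remaining_insert_old[of S K v] card_remaining_insert_old[of "insert v S" K "(g, h')"]
          fin K g h h' D by auto
      moreover have "odd_fibres ?T"
        using odd_fibres_insert_two[OF less.prems(1) g h(2) h'(3)] h'(2) by auto
      ultimately have "B_forces (blow_up F K) Player_A ?T"
        using less.hyps blow_up_insert[OF mv] D(2) less.prems(3) by simp
      then show ?thesis using mv by (rule B_forces.B_moves[rotated])
    qed
    then show ?case using ne by (intro B_forces.A_moves)
  qed
next
  case (B_stuck P)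
  \<comment> \<open>With B stuck in the original game, evenly many free places remain in the blow-up
    and B is to move, so A takes the last one.\<close>
  then show ?case
    using B_forces_blow_up_maximal[OF K(1), of S F Player_B] even_card_remaining[OF _ _ K, of S F]
    by (simp add: odd_fibres_def)
next
  case (B_moves g P)
  obtain h where h: "h \<in> K" using K by fastforce
  have g: "g \<notin> Domain S" using B_moves by (auto simp: moves_def)
  have mv: "(g, h) \<in> moves (blow_up F K) S"
    using moves_blow_up_new[OF B_moves.prems(2) g] h B_moves by blast
  moreover have "B_forces (blow_up F K) Player_A (insert (g, h) S)"
    using B_moves odd_fibres_insert_new[OF _ g] blow_up_insert[OF mv] by simp
  ultimately show ?case by (rule B_forces.B_moves)
qed

text \<open>Conversely, B simulates a play of the blown-up game in which A answers every move of B in an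
  opened fibre within that fibre; the second conjunct covers the position in between.\<close>

lemma B_forces_of_blow_up:
  assumes K: "finite K" "odd (card K)" and "B_forces (blow_up F K) X S" "blow_up F K S"
  shows "(odd_fibres S \<longrightarrow> B_forces F X (Domain S)) \<and>
    (X = Player_A \<longrightarrow> (\<forall>v\<in>moves (blow_up F K) S. fst v \<in> Domain S \<longrightarrow>
      odd_fibres (insert v S) \<longrightarrow> B_forces F Player_B (Domain S)))"
  using assms(3,4)
proof (induction X S rule: B_forces.induct)
  case (A_moves S)
  have "B_forces (blow_up F K) Player_A S"
    by (rule B_forces.A_moves[OF A_moves.hyps])
  \<comment> \<open>If no new fibre could be opened, A would be to move with evenly many free places
    left, and B would select last.\<close>
  then have ne: "moves F (Domain S) \<noteq> {}" if "odd_fibres S"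
    using B_forces_blow_up_maximal[OF K(1) _ A_moves.prems, of Player_A] that
      even_card_remaining[OF that A_moves.prems K] unfolding odd_fibres_def by blast
  obtain h where h: "h \<in> K" using K by fastforce
  have "B_forces F Player_B (insert g (Domain S))"
    if "odd_fibres S" "g \<in> moves F (Domain S)" for g
  proof -
    have g: "g \<notin> Domain S" using that(2) by (simp add: moves_def)
    have mv: "(g, h) \<in> moves (blow_up F K) S"
      using moves_blow_up_new[OF A_moves.prems g] h that(2) by blast
    show ?thesis
      using A_moves.IH[OF mv blow_up_insert[OF mv]] odd_fibres_insert_new[OF that(1) g] by simp
  qed
  then have "odd_fibres S \<longrightarrow> B_forces F Player_A (Domain S)"
    using ne by (auto intro: B_forces.A_moves)
  \<comment> \<open>Here \<open>v\<close> is A's pairing reply: it restores odd fibres without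
    changing the projection, so the first conjunct of the induction hypothesis applies after
    it.\<close>
  moreover have "B_forces F Player_B (Domain S)"
    if v: "v \<in> moves (blow_up F K) S" "fst v \<in> Domain S" "odd_fibres (insert v S)" for v
  proof -
    have "Domain (insert v S) = Domain S" using v(2) by (cases v) auto
    then show ?thesis using A_moves.IH[OF v(1) blow_up_insert[OF v(1)]] v(3) by simp
  qed
  ultimately show ?case by blast
next
  case (B_stuck S)
  obtain h where h: "h \<in> K" using K by fastforce
  have "moves F (Domain S) = {}"
  proof (rule ccontr)
    assume "moves F (Domain S) \<noteq> {}"
    then obtain g where g: "g \<in> moves F (Domain S)" by blast
    then have "g \<notin> Domain S" by (simp add: moves_def)
    then show False using moves_blow_up_new[OF B_stuck.prems] g h B_stuck.hyps by blast
  qed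
  then show ?case by (auto intro: B_forces.B_stuck)
next
  case (B_moves v S)
  obtain g h where [simp]: "v = (g, h)" by fastforce
  note mv = B_moves.hyps(1) and IH = B_moves.IH[OF blow_up_insert[OF B_moves.hyps(1)]]
  have "B_forces F Player_B (Domain S)" if odd: "odd_fibres S"
  proof (cases "g \<in> Domain S")
    case False
    have "g \<in> moves F (Domain S)" using moves_blow_up_new[OF B_moves.prems False] mv by simp
    moreover have "B_forces F Player_A (insert g (Domain S))"
      using IH odd_fibres_insert_new[OF odd False] by simp
    ultimately show ?thesis by (rule B_forces.B_moves)
  next
    case True
    have h: "h \<in> K" "(g, h) \<notin> S" using moves_blow_up_old[OF B_moves.prems True] mv by auto
    obtain h' where h': "h' \<in> K" "h' \<noteq> h" "(g, h') \<notin> S"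
      by (rule odd_fibres_partner[OF odd B_moves.prems K True h])
    have D: "Domain (insert v S) = Domain S" using True by auto
    have "(g, h') \<in> moves (blow_up F K) (insert v S)"
      using moves_blow_up_old[OF blow_up_insert[OF mv], of g h'] h' D True by auto
    moreover have "odd_fibres (insert (g, h') (insert v S))"
      using odd_fibres_insert_two[OF odd True h(2) h'(3)] h'(2) by auto
    \<comment> \<open>The second conjunct of the induction hypothesis, with A replying at
      \<open>(g, h')\<close>, returns to the unchanged projection with B to move.\<close>
    ultimately show ?thesis using IH D True by (metis fst_conv)
  qed
  then show ?case by simp
qed

section \<open>The outcome for odd and for even fibre size\<close>

lemma B_forces_blow_up_odd_iff:
  fixes F :: "'a set \<Rightarrow> bool" and K :: "'b set"
  assumes "finite K" "odd (card K)" "F {}"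
  shows "B_forces (blow_up F K) Player_A {} \<longleftrightarrow> B_forces F Player_A {}"
proof -
  have "odd_fibres ({} :: ('a \<times> 'b) set)" "blow_up F K {}"
    using assms(3) by (auto simp: odd_fibres_def blow_up_def)
  then show ?thesis
    using B_forces_blow_up[OF assms(1,2), of F Player_A "{}" "{}"]
      B_forces_of_blow_up[OF assms(1,2), of F Player_A "{}"] by auto
qed

text \<open>A play won by B ends with B to move at a union of full fibres, whose size is a multiple
  of \<open>card K\<close> and so even. Each move flips both the player and the parity, which
  carries the law back to \<open>S\<close>.\<close>

lemma B_forces_blow_up_even_parity:
  assumes "even (card K)" "B_forces (blow_up F K) X S" "finite S" "blow_up F K S"
  shows "X = Player_A \<longleftrightarrow> odd (card S)"
  using assms(2-4)
proof (induction X S rule: B_forces.induct)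
  case (A_moves S)
  then obtain v where v: "v \<in> moves (blow_up F K) S" by blast
  then have "v \<notin> S" by (simp add: moves_def)
  then show ?case using A_moves.IH[OF v] A_moves.prems blow_up_insert[OF v] by simp
next
  case (B_stuck S)
  \<comment> \<open>Any free place of an opened fibre would still be a legal move.\<close>
  have "S = Domain S \<times> K"
    using moves_blow_up_old[OF B_stuck.prems(2)] B_stuck.hyps B_stuck.prems(2)
    by (auto simp: blow_up_def)
  then have "card S = card (Domain S) * card K" by (metis card_cartesian_product)
  then show ?case using assms(1) by simp
next
  case (B_moves v S)
  then have "v \<notin> S" by (simp add: moves_def)
  then show ?case using B_moves.IH B_moves.prems blow_up_insert[OF B_moves.hyps(1)] by simp
qed

theorem theorem5p4:
  fixes G :: "'a pair_pre_digraph" and K :: "'b pair_pre_digraph" and n :: nat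
  assumes "simple_graph G"
    and "Digraph_Component.connected (with_proj G)"
    and "n \<ge> 1"
    and "complete_digraph n (with_proj K)"
  shows "wins_avoidance_game Player_B (lexicographic_product G K) \<longleftrightarrow>
    wins_avoidance_game Player_B G \<and> odd n"
proof -
  interpret pair_bidirected_digraph G by fact
  have K: "finite (pverts K)" "card (pverts K) = n"
    "parcs K = {(u, v). (u, v) \<in> pverts K \<times> pverts K \<and> u \<noteq> v}"
    using assms(4) by (auto simp: complete_digraph_pair_def)
  let ?F = "general_position_set G"
  have empty: "?F {}" by (simp add: general_position_set_def)
  \<comment> \<open>The projection of a set of pairs is its \<open>Domain\<close>, so the criterion
    for the product has the form of a blow-up.\<close>
  have "general_position_set (lexicographic_product G K) = blow_up ?F (pverts K)"
    using general_position_set_lexicographic_product_complete[OF K(3)]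
    by (auto simp: blow_up_def Domain_fst)
  then have win: "wins_avoidance_game Player_B (lexicographic_product G K) \<longleftrightarrow>
      B_forces (blow_up ?F (pverts K)) Player_A {}"
    by (simp add: wins_avoidance_game_iff_B_forces)
  show ?thesis
  proof (cases "odd n")
    case True
    then show ?thesis
      using win B_forces_blow_up_odd_iff[of "pverts K" ?F] K empty
      by (simp add: wins_avoidance_game_iff_B_forces)
  next
    case False
    \<comment> \<open>At the start A is to move with 0 vertices selected, whereas the parity law
      demands an odd number.\<close>
    then have "\<not> B_forces (blow_up ?F (pverts K)) Player_A {}"
      using B_forces_blow_up_even_parity[of "pverts K" ?F Player_A "{}"] K empty
      by (auto simp: blow_up_def)
    with win False show ?thesis by simp
  qed
qed

end
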